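(* Let $n \geq 1$ be an integer, let $x=(x_1,\dots,x_n)\in\mathbb{R}^n$ be a (deterministic) vector with $\|x\|_2=1$, and let $\varepsilon=(\varepsilon_1,\dots,\varepsilon_n)$ be a random vector in $\mathbb{R}^n$ whose coordinates $\varepsilon_i$ are independent random variables with $\Pr(\varepsilon_i=1)=\Pr(\varepsilon_i=-1)=\frac12$ for each $i$. Then $$\Pr\left(|\varepsilon^T x|\leq 1\right)\geq 0.36 .$$
   Context: Here $\|x\|_2=\left(\sum_{i=1}^n x_i^2\right)^{1/2}$ is the Euclidean norm and $\varepsilon^T x=\sum_{i=1}^n \varepsilon_i x_i$. *)

theory Defs
  imports "HOL-Analysis.Analysis" "HOL-Probability.Probability"
begin

end

theory Submission
  imports Defs
begin

text \<open>
  Order the coordinates so that \<open>x\<^sub>1 \<ge> x\<^sub>2 \<ge> \<dots> \<ge> 0\<close>. If \<open>x\<^sub>1 + x\<^sub>2 > 1\<close>, condition on the sum \<open>r\<close> of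
  the other terms: at least \<open>2 - r\<^sup>2\<close> of the four sums \<open>\<plusminus>x\<^sub>1 \<plusminus> x\<^sub>2 + r\<close> lie in \<open>[-1, 1]\<close>, and the
  variance of \<open>r\<close> is at most \<open>1/2\<close>, which gives \<open>3/8\<close>. Otherwise run the walk of partial sums and stop
  it at the first \<open>s\<close> with \<open>\<bar>s\<bar> > 1 - y\<close>, where \<open>y\<close> is the next step. Then \<open>\<bar>s\<bar> \<le> 1\<close>, and at least two
  steps have been made, so the remaining sum \<open>r\<close> has variance \<open>Q \<le> 1 - 2y\<^sup>2 \<le> (3/10) (1 + \<bar>s\<bar>)\<^sup>2\<close>. One of
  \<open>s + r\<close>, \<open>s - r\<close> is in \<open>[-1, 1]\<close> as soon as \<open>\<bar>r\<bar> \<le> 1 + \<bar>s\<bar>\<close>, and Markov's inequality for the fourth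
  moment, which is at most \<open>3Q\<^sup>2\<close>, yields the probability \<open>(1 - 3 \<cdot> 9/100) / 2 > 0.36\<close>.
\<close>

section \<open>Averages over all choices of signs\<close>

text \<open>The expectation of \<open>f\<close> at a random signed sum of the list, as a finite
  recursion: the estimates become list inductions, and \<open>prob_sign_sum\<close> makes the link
  to probability.\<close>

fun sign_avg :: "real list \<Rightarrow> (real \<Rightarrow> real) \<Rightarrow> real" where
  "sign_avg [] f = f 0"
| "sign_avg (y # ys) f = (sign_avg ys (\<lambda>r. f (y + r)) + sign_avg ys (\<lambda>r. f (- y + r))) / 2"

lemma sign_avg_mono: "(\<And>r. f r \<le> g r) \<Longrightarrow> sign_avg ys f \<le> sign_avg ys g"
  by (induction ys arbitrary: f g) (auto intro!: add_mono divide_right_mono)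

lemma sign_avg_const [simp]: "sign_avg ys (\<lambda>r. c) = c"
  by (induction ys) auto

lemma sign_avg_add: "sign_avg ys (\<lambda>r. f r + g r) = sign_avg ys f + sign_avg ys g"
  by (induction ys arbitrary: f g) (auto simp: field_simps)

lemma sign_avg_cmult: "sign_avg ys (\<lambda>r. c * f r) = c * sign_avg ys f"
  by (induction ys arbitrary: f) (auto simp: field_simps)

lemma sign_avg_diff: "sign_avg ys (\<lambda>r. f r - g r) = sign_avg ys f - sign_avg ys g"
  using sign_avg_add[of ys f "\<lambda>r. (-1) * g r"] sign_avg_cmult[of ys "-1" g] by simp

lemma sign_avg_uminus: "sign_avg ys (\<lambda>r. f (- r)) = sign_avg ys f"
proof (induction ys arbitrary: f)
  case (Cons y ys)
  have "sign_avg ys (\<lambda>r. f (- (y + r))) = sign_avg ys (\<lambda>r. f (- y + r))"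
    using Cons[of "\<lambda>r. f (- y + r)"] by simp
  moreover have "sign_avg ys (\<lambda>r. f (- (- y + r))) = sign_avg ys (\<lambda>r. f (y + r))"
    using Cons[of "\<lambda>r. f (y + r)"] by simp
  ultimately show ?case
    by simp
qed simp

lemma sign_avg_map_abs: "sign_avg (map abs ys) f = sign_avg ys f"
  by (induction ys arbitrary: f) (auto simp: abs_if add.commute)

lemma sign_avg_square: "sign_avg ys (\<lambda>r. r\<^sup>2) = (\<Sum>y\<leftarrow>ys. y\<^sup>2)"
proof (induction ys)
  case (Cons y ys)
  have "sign_avg (y # ys) (\<lambda>r. r\<^sup>2) = sign_avg ys (\<lambda>r. (y + r)\<^sup>2 + (- y + r)\<^sup>2) / 2"
    by (simp add: sign_avg_add)
  also have "(\<lambda>r. (y + r)\<^sup>2 + (- y + r)\<^sup>2) = (\<lambda>r. 2 * y\<^sup>2 + 2 * r\<^sup>2)"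
    by (auto simp: power2_eq_square algebra_simps)
  finally show ?case
    using Cons by (simp add: sign_avg_add sign_avg_cmult)
qed simp

text \<open>Odd powers of \<open>r\<close> cancel between the two signs of \<open>y\<close>. The
  factor 3 makes the mixed term 6 y^2 Q match that of the square, which leaves a slack of 2
  y^4.\<close>

lemma sign_avg_fourth_power: "sign_avg ys (\<lambda>r. r ^ 4) \<le> 3 * (\<Sum>y\<leftarrow>ys. y\<^sup>2)\<^sup>2"
proof (induction ys)
  case (Cons y ys)
  let ?Q = "\<Sum>y\<leftarrow>ys. y\<^sup>2"
  have "sign_avg (y # ys) (\<lambda>r. r ^ 4) = sign_avg ys (\<lambda>r. (y + r) ^ 4 + (- y + r) ^ 4) / 2"
    by (simp add: sign_avg_add)
  also have "(\<lambda>r. (y + r) ^ 4 + (- y + r) ^ 4) = (\<lambda>r. 2 * y ^ 4 + (12 * y\<^sup>2 * r\<^sup>2 + 2 * r ^ 4))"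
    by (auto simp: power2_eq_square power4_eq_xxxx algebra_simps)
  also have "sign_avg ys \<dots> / 2 = y ^ 4 + 6 * y\<^sup>2 * ?Q + sign_avg ys (\<lambda>r. r ^ 4)"
    by (simp add: sign_avg_add sign_avg_cmult sign_avg_square)
  also have "\<dots> \<le> y ^ 4 + 6 * y\<^sup>2 * ?Q + 3 * ?Q\<^sup>2"
    using Cons by simp
  also have "\<dots> \<le> 3 * (y\<^sup>2 + ?Q)\<^sup>2"
    using zero_le_even_power[of 4 y]
    by (simp add: power2_eq_square power4_eq_xxxx algebra_simps)
  finally show ?case
    by simp
qed simp

section \<open>Stopping the walk\<close>

text \<open>If |r| \<le> 1 + |s|, adding |r| with the sign opposite to \<open>s\<close> gives the
  absolute value ||r| - |s|| \<le> 1; otherwise the left side is at most 0. This is a pointwise form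
  of Markov's inequality, ready to be averaged.\<close>

lemma reflected_sum_count:
  fixes r s :: real
  assumes "\<bar>s\<bar> \<le> 1"
  shows "1 - r ^ 4 / (1 + \<bar>s\<bar>) ^ 4 \<le> of_bool (\<bar>s + r\<bar> \<le> 1) + of_bool (\<bar>s - r\<bar> \<le> 1)"
proof (cases "\<bar>r\<bar> \<le> 1 + \<bar>s\<bar>")
  case True
  then have "\<bar>s + r\<bar> \<le> 1 \<or> \<bar>s - r\<bar> \<le> 1"
    using assms by linarith
  moreover have "0 \<le> r ^ 4 / (1 + \<bar>s\<bar>) ^ 4"
    by simp
  ultimately show ?thesis
    by (smt (verit, del_insts) of_bool_eq)
next
  case False
  then have "(1 + \<bar>s\<bar>) ^ 4 \<le> \<bar>r\<bar> ^ 4"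
    by (intro power_mono) auto
  then have "1 \<le> r ^ 4 / (1 + \<bar>s\<bar>) ^ 4"
    by (simp add: power_even_abs add_pos_nonneg)
  then have "1 - r ^ 4 / (1 + \<bar>s\<bar>) ^ 4 \<le> 0"
    by simp
  also have "0 \<le> of_bool (\<bar>s + r\<bar> \<le> 1) + (of_bool (\<bar>s - r\<bar> \<le> 1) :: real)"
    by simp
  finally show ?thesis .
qed

text \<open>Meant for \<open>ys\<close> the list of all steps not yet made and \<open>y\<close> the
  next one. The last hypothesis reflects a total square sum of 1 with two earlier steps of size at
  least \<open>y\<close>.\<close>

lemma sign_avg_stopped:
  assumes "\<bar>s\<bar> \<le> 1" "\<bar>s\<bar> > 1 - y" "0 \<le> y" "(\<Sum>z\<leftarrow>ys. z\<^sup>2) + 2 * y\<^sup>2 \<le> 1"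
  shows "0.36 \<le> sign_avg ys (\<lambda>r. of_bool (\<bar>s + r\<bar> \<le> 1))"
proof -
  let ?g = "\<lambda>r. of_bool (\<bar>s + r\<bar> \<le> 1) :: real"
  define Q where "Q = (\<Sum>z\<leftarrow>ys. z\<^sup>2)"
  define a where "a = 1 + \<bar>s\<bar>"
  have "0 \<le> Q"
    unfolding Q_def by (rule sum_list_nonneg) auto
  have "0 < a"
    by (simp add: a_def add_pos_nonneg)
  have "2 * y\<^sup>2 \<le> 1"
    using assms(4) \<open>0 \<le> Q\<close> by (simp add: Q_def)
  then have "y\<^sup>2 \<le> 1\<^sup>2"
    by simp
  then have "y \<le> 1"
    using power2_le_imp_le zero_le_one by blast
  have "Q \<le> 1 - 2 * y\<^sup>2"
    using assms(4) by (simp add: Q_def)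
  \<comment> \<open>Ten times the difference of the sides is 23 y^2 - 12 y + 2, and 23 times this is
    (23 y - 6)^2 + 10.\<close>
  also have "\<dots> \<le> 3 / 10 * (2 - y)\<^sup>2"
    using zero_le_power2[of "23 * y - 6"] by (simp add: power2_eq_square algebra_simps)
  \<comment> \<open>The stopping condition gives \<open>2 - y < a\<close>, and
    \<open>y \<le> 1\<close> keeps \<open>2 - y\<close> nonnegative, so squaring preserves the
    order.\<close>
  also have "\<dots> \<le> 3 / 10 * a\<^sup>2"
    using \<open>y \<le> 1\<close> assms(2) by (intro mult_left_mono power_mono) (auto simp: a_def)
  finally have "Q\<^sup>2 \<le> (3 / 10 * a\<^sup>2)\<^sup>2"
    using \<open>0 \<le> Q\<close> by (rule power_mono)
  then have Q: "3 * Q\<^sup>2 / a ^ 4 \<le> 27 / 100"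
    using \<open>0 < a\<close> by (simp add: power_mult_distrib field_simps power2_eq_square power4_eq_xxxx)
  \<comment> \<open>The left side is 0.73; the reflection below halves it to 0.365.\<close>
  have "1 - 27 / 100 \<le> 1 - sign_avg ys (\<lambda>r. r ^ 4) / a ^ 4"
  proof -
    have "sign_avg ys (\<lambda>r. r ^ 4) / a ^ 4 \<le> 3 * Q\<^sup>2 / a ^ 4"
      unfolding Q_def by (intro divide_right_mono sign_avg_fourth_power) simp
    then show ?thesis
      using Q by linarith
  qed
  also have "\<dots> = sign_avg ys (\<lambda>r. 1 - r ^ 4 / a ^ 4)"
    using sign_avg_cmult[of ys "1 / a ^ 4" "\<lambda>r. r ^ 4"] by (simp add: sign_avg_diff)
  also have "\<dots> \<le> sign_avg ys (\<lambda>r. ?g r + ?g (- r))"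
    using reflected_sum_count[OF assms(1)] by (intro sign_avg_mono) (simp add: a_def)
  also have "\<dots> = 2 * sign_avg ys ?g"
    using sign_avg_uminus[of ys ?g] by (simp add: sign_avg_add)
  finally show ?thesis
    by simp
qed

text \<open>The square-sum condition passes to tails, since dropping a step only lowers the sum. A
  walk that never stops ends with |s| \<le> 1, where the average is 1.\<close>

lemma sign_avg_walk:
  assumes "\<bar>s\<bar> \<le> 1" "\<And>y. y \<in> set ys \<Longrightarrow> 0 \<le> y"
    and "\<And>y. y \<in> set ys \<Longrightarrow> (\<Sum>z\<leftarrow>ys. z\<^sup>2) + 2 * y\<^sup>2 \<le> 1"
  shows "0.36 \<le> sign_avg ys (\<lambda>r. of_bool (\<bar>s + r\<bar> \<le> 1))"
  using assms
proof (induction ys arbitrary: s)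
  case (Cons y ys)
  show ?case
  proof (cases "\<bar>s\<bar> > 1 - y")
    case True
    \<comment> \<open>The walk stops before the step \<open>y\<close> is made, so the remaining sum
      runs over all of \<open>y # ys\<close>.\<close>
    then show ?thesis
      using Cons.prems(1) Cons.prems(2)[of y] Cons.prems(3)[of y] zero_le_power2[of y]
      by (intro sign_avg_stopped[of s y]) (simp_all del: zero_le_power2)
  next
    case False
    have bound: "(\<Sum>z\<leftarrow>ys. z\<^sup>2) + 2 * w\<^sup>2 \<le> 1" if "w \<in> set ys" for w
    proof -
      have "0 \<le> y\<^sup>2" "y\<^sup>2 + (\<Sum>z\<leftarrow>ys. z\<^sup>2) + 2 * w\<^sup>2 \<le> 1"
        using Cons.prems(3)[of w] that by simp_all
      then show ?thesis
        by linarith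
    qed
    have "0 \<le> y"
      using Cons.prems by simp
    then have "\<bar>s + y\<bar> \<le> 1" "\<bar>s - y\<bar> \<le> 1"
      using False by linarith+
    then have "0.36 \<le> sign_avg ys (\<lambda>r. of_bool (\<bar>s + y + r\<bar> \<le> 1))"
      and "0.36 \<le> sign_avg ys (\<lambda>r. of_bool (\<bar>s - y + r\<bar> \<le> 1))"
      using Cons.prems bound by (intro Cons.IH; force)+
    then show ?thesis
      by (simp add: algebra_simps)
  qed
qed simp

section \<open>Splitting off the two largest coordinates\<close>

text \<open>As |r| passes 1 - (p - q), 1 + (p - q) and 1 + p + q, the guaranteed number of sums in
  range goes through 2, 2, 1, 0, while \<open>r\<^sup>2\<close> is at least 1 in the third range and
  at least 2 in the last.\<close>

lemma four_sums_count:
  fixes p q r :: real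
  assumes "1 < p + q" "q \<le> p" "0 \<le> q" "p \<le> 1"
  shows "2 - r\<^sup>2 \<le> of_bool (\<bar>p + q + r\<bar> \<le> 1) + of_bool (\<bar>p - q + r\<bar> \<le> 1)
    + of_bool (\<bar>- p + q + r\<bar> \<le> 1) + of_bool (\<bar>- p - q + r\<bar> \<le> 1)"
proof -
  have *: "2 \<le> r\<^sup>2" if "\<bar>r\<bar> > 2"
  proof -
    have "2\<^sup>2 \<le> \<bar>r\<bar>\<^sup>2"
      using that by (intro power_mono) auto
    then show ?thesis by simp
  qed
  have **: "1 \<le> r\<^sup>2" if "\<bar>r\<bar> > 1"
  proof -
    have "1\<^sup>2 \<le> \<bar>r\<bar>\<^sup>2"
      using that by (intro power_mono) auto
    then show ?thesis by simp
  qed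
  consider "\<bar>r\<bar> \<le> 1 - (p - q)" | "1 - (p - q) < \<bar>r\<bar>" "\<bar>r\<bar> \<le> 1 + (p - q)"
    | "1 + (p - q) < \<bar>r\<bar>" "\<bar>r\<bar> \<le> 1 + p + q" | "1 + p + q < \<bar>r\<bar>"
    by linarith
  then show ?thesis
  proof cases
    case 1
    then have "\<bar>p - q + r\<bar> \<le> 1" "\<bar>- p + q + r\<bar> \<le> 1"
      using assms by linarith+
    then show ?thesis
      by (simp add: add_increasing add_increasing2)
  next
    case 2
    \<comment> \<open>From p \<le> 1 follows |r| > 1 - (p - q) \<ge> p + q - 1, so |r| is within 1
      of p + q as well as of p - q.\<close>
    then have "(\<bar>p - q + r\<bar> \<le> 1 \<or> \<bar>- p + q + r\<bar> \<le> 1) \<and> (\<bar>p + q + r\<bar> \<le> 1 \<or> \<bar>- p - q + r\<bar> \<le> 1)"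
      using assms by linarith
    then show ?thesis
      using zero_le_power2[of r] by (smt (verit, del_insts) of_bool_eq)
  next
    case 3
    then have "\<bar>p + q + r\<bar> \<le> 1 \<or> \<bar>- p - q + r\<bar> \<le> 1"
      using assms by linarith
    moreover have "1 \<le> r\<^sup>2"
      using 3 assms by (intro **) linarith
    ultimately show ?thesis
      by (auto simp: of_bool_def)
  next
    case 4
    then have "2 \<le> r\<^sup>2"
      using assms by (intro *) linarith
    then have "2 - r\<^sup>2 \<le> 0" by simp
    also have "0 \<le> of_bool (\<bar>p + q + r\<bar> \<le> 1) + of_bool (\<bar>p - q + r\<bar> \<le> 1)
    + of_bool (\<bar>- p + q + r\<bar> \<le> 1) + (of_bool (\<bar>- p - q + r\<bar> \<le> 1) :: real)"
      by simp
    finally show ?thesis .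
  qed
qed

lemma sign_avg_sorted:
  assumes "sorted_wrt (\<ge>) zs" "\<And>z. z \<in> set zs \<Longrightarrow> 0 \<le> z" "(\<Sum>z\<leftarrow>zs. z\<^sup>2) = 1"
  shows "0.36 \<le> sign_avg zs (\<lambda>r. of_bool (\<bar>r\<bar> \<le> 1))"
proof -
  consider "zs = []" | p where "zs = [p]" | p q ys where "zs = p # q # ys"
    by (metis neq_Nil_conv)
  then show ?thesis
  proof cases
    case 1
    then show ?thesis by simp
  next
    case (2 p)
    then have "p = 1"
      using assms power2_eq_1_iff[of p] by auto
    with 2 show ?thesis by simp
  next
    case (3 p q ys)
    define Q where "Q = (\<Sum>z\<leftarrow>ys. z\<^sup>2)"
    have le_q: "y \<le> q" and nonneg: "0 \<le> y" if "y \<in> set ys" for y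
      using assms 3 that by auto
    have pq: "p\<^sup>2 + q\<^sup>2 + Q = 1" "0 \<le> q" "q \<le> p"
      using assms 3 by (auto simp: Q_def)
    have "0 \<le> Q"
      unfolding Q_def by (rule sum_list_nonneg) auto
    show ?thesis
    proof (cases "p + q > 1")
      case True
      have "p\<^sup>2 \<le> 1\<^sup>2"
        using pq(1) \<open>0 \<le> Q\<close> zero_le_power2[of q] unfolding one_power2 by linarith
      then have "p \<le> 1"
        using power2_le_imp_le zero_le_one by blast
      \<comment> \<open>At least half of the total square sum lies in \<open>p\<close> and
        \<open>q\<close>, so \<open>2 - Q\<close> is at least 3/2, above 4 * 0.36 = 1.44.\<close>
      have "1 \<le> (p + q)\<^sup>2"
        using True by (simp add: power2_eq_square) (metis less_1_mult less_imp_le)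
      also have "\<dots> \<le> 2 * (p\<^sup>2 + q\<^sup>2)"
        using zero_le_power2[of "p - q"] by (simp add: power2_eq_square algebra_simps)
      finally have "Q \<le> 1 / 2"
        using pq by simp
      then have "4 * 0.36 \<le> 2 - Q" by simp
      also have "\<dots> = sign_avg ys (\<lambda>r. 2 - r\<^sup>2)"
        by (simp add: sign_avg_diff sign_avg_square Q_def)
      also have "\<dots> \<le> sign_avg ys (\<lambda>r. of_bool (\<bar>p + q + r\<bar> \<le> 1) + of_bool (\<bar>p - q + r\<bar> \<le> 1)
        + of_bool (\<bar>- p + q + r\<bar> \<le> 1) + of_bool (\<bar>- p - q + r\<bar> \<le> 1))"
        using four_sums_count True pq \<open>p \<le> 1\<close> by (intro sign_avg_mono) blast
      also have "\<dots> = 4 * sign_avg zs (\<lambda>r. of_bool (\<bar>r\<bar> \<le> 1))"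
        by (simp add: 3 sign_avg_add add_divide_distrib algebra_simps)
      finally show ?thesis by simp
    next
      case False
      have walk: "0.36 \<le> sign_avg ys (\<lambda>r. of_bool (\<bar>s + r\<bar> \<le> 1))" if "\<bar>s\<bar> \<le> 1" for s
      proof (rule sign_avg_walk[OF that nonneg])
        fix y assume y: "y \<in> set ys"
        \<comment> \<open>Both split-off coordinates dominate \<open>y\<close>, so p^2 + q^2 \<ge> 2
          y^2, which is the room that the walk needs.\<close>
        have "y\<^sup>2 \<le> p\<^sup>2" "y\<^sup>2 \<le> q\<^sup>2"
          using le_q[OF y] nonneg[OF y] pq by (auto intro!: power_mono)
        then show "(\<Sum>z\<leftarrow>ys. z\<^sup>2) + 2 * y\<^sup>2 \<le> 1"
          using pq by (simp add: Q_def)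
      qed
      have "\<bar>p + q\<bar> \<le> 1" "\<bar>p - q\<bar> \<le> 1" "\<bar>- p + q\<bar> \<le> 1" "\<bar>- p - q\<bar> \<le> 1"
        using False pq by linarith+
      from this[THEN walk] show ?thesis
        by (simp add: 3 add_divide_distrib algebra_simps)
    qed
  qed
qed

section \<open>From independent random signs to sign averages\<close>

text \<open>Conditioning on the first sign translates the target set, hence the induction for
  arbitrary \<open>A\<close>.\<close>

lemma (in prob_space) prob_sign_sum:
  fixes X :: "'i \<Rightarrow> 'a \<Rightarrow> real"
  assumes "indep_vars (\<lambda>_. borel) X (set is)" "distinct is"
    and "\<And>i. i \<in> set is \<Longrightarrow> prob {\<omega> \<in> space M. X i \<omega> = 1} = 1 / 2"
    and "\<And>i. i \<in> set is \<Longrightarrow> prob {\<omega> \<in> space M. X i \<omega> = - 1} = 1 / 2"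
    and "A \<in> sets borel"
  shows "prob {\<omega> \<in> space M. (\<Sum>i\<in>set is. X i \<omega> * c i) \<in> A} = sign_avg (map c is) (indicator A)"
  using assms
proof (induction "is" arbitrary: A)
  case Nil
  show ?case
    by (cases "0 \<in> A") (auto simp: prob_space)
next
  case (Cons i "is")
  define R where "R \<omega> = (\<Sum>j\<in>set is. X j \<omega> * c j)" for \<omega>
  \<comment> \<open>Scaling every variable except \<open>X i\<close> yields the independence of the
    bare sign \<open>X i\<close> from the weighted sum \<open>R\<close>.\<close>
  let ?Z = "\<lambda>j \<omega>. (if j = i then X j \<omega> else X j \<omega> * c j)"
  have [measurable]: "random_variable borel (X j)" if "j \<in> set (i # is)" for j
    using Cons.prems(1) that by (auto simp: indep_vars_def)
  have Xi [measurable]: "random_variable borel (X i)"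
    by measurable
  have R [measurable]: "random_variable borel R"
    unfolding R_def by measurable
  have [measurable]: "A \<in> sets borel"
    by (fact Cons.prems)
  have notin: "i \<notin> set is"
    using Cons.prems by simp
  have "indep_vars (\<lambda>_. borel) ?Z (set (i # is))"
    by (rule indep_vars_compose2[where Y = "\<lambda>j x. if j = i then x else x * c j", OF Cons.prems(1)]) auto
  then have "indep_var borel (?Z i) borel (\<lambda>\<omega>. \<Sum>j\<in>set is. ?Z j \<omega>)"
    using notin by (intro indep_vars_sum) auto
  also have "(\<lambda>\<omega>. \<Sum>j\<in>set is. ?Z j \<omega>) = R"
    using notin by (intro ext) (auto simp: R_def intro!: sum.cong)
  finally have indep: "indep_var borel (X i) borel R"
    by simp
  have half: "prob {\<omega> \<in> space M. X i \<omega> = e \<and> e * c i + R \<omega> \<in> A}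
      = sign_avg (map c is) (\<lambda>r. indicator A (e * c i + r)) / 2" if "e \<in> {1, - 1}" for e
  proof -
    let ?B = "(\<lambda>r. e * c i + r) -` A"
    have B: "?B \<in> sets borel"
      using measurable_sets[of "\<lambda>r. e * c i + r" borel borel A] by simp
    have "{\<omega> \<in> space M. X i \<omega> = e \<and> e * c i + R \<omega> \<in> A}
        = (\<lambda>\<omega>. (X i \<omega>, R \<omega>)) -` ({e} \<times> ?B) \<inter> space M"
      by auto
    then have "prob {\<omega> \<in> space M. X i \<omega> = e \<and> e * c i + R \<omega> \<in> A}
        = prob (X i -` {e} \<inter> space M) * prob (R -` ?B \<inter> space M)"
      using indep_varD[OF indep, of "{e}" ?B] B by simp
    also have "X i -` {e} \<inter> space M = {\<omega> \<in> space M. X i \<omega> = e}"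
      by auto
    also have "prob \<dots> = 1 / 2"
      using that Cons.prems(3,4)[of i] by auto
    also have "R -` ?B \<inter> space M = {\<omega> \<in> space M. R \<omega> \<in> ?B}"
      by auto
    also have "prob \<dots> = sign_avg (map c is) (indicator ?B)"
      unfolding R_def using Cons.prems B
      by (intro Cons.IH indep_vars_subset[OF Cons.prems(1)]) auto
    also have "indicator ?B = (\<lambda>r. indicator A (e * c i + r))"
      by (auto simp: indicator_def)
    finally show ?thesis
      by simp
  qed
  \<comment> \<open>The two halves exhaust the mass, so other values of \<open>X i\<close> occur
    only on a null set.\<close>
  have "prob {\<omega> \<in> space M. X i \<omega> = 1 \<or> X i \<omega> = - 1}
      = prob ({\<omega> \<in> space M. X i \<omega> = 1} \<union> {\<omega> \<in> space M. X i \<omega> = - 1})"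
    by (rule arg_cong[of _ _ prob]) auto
  also have "\<dots> = 1"
    using Cons.prems(3,4)[of i] by (subst finite_measure_Union) auto
  finally have AE: "AE \<omega> in M. X i \<omega> = 1 \<or> X i \<omega> = - 1"
    by (subst (asm) prob_Collect_eq_1) auto
  have "prob {\<omega> \<in> space M. (\<Sum>j\<in>set (i # is). X j \<omega> * c j) \<in> A}
      = prob {\<omega> \<in> space M. X i \<omega> * c i + R \<omega> \<in> A}"
    using notin by (simp add: R_def)
  also have "\<dots> = prob ({\<omega> \<in> space M. X i \<omega> = 1 \<and> 1 * c i + R \<omega> \<in> A}
      \<union> {\<omega> \<in> space M. X i \<omega> = - 1 \<and> - 1 * c i + R \<omega> \<in> A})"
    using AE by (intro measure_eq_AE) (auto elim!: eventually_mono)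
  also have "\<dots> = prob {\<omega> \<in> space M. X i \<omega> = 1 \<and> 1 * c i + R \<omega> \<in> A}
      + prob {\<omega> \<in> space M. X i \<omega> = - 1 \<and> - 1 * c i + R \<omega> \<in> A}"
    by (intro finite_measure_Union) auto
  also have "\<dots> = sign_avg (map c (i # is)) (indicator A)"
    using half[of 1] half[of "- 1"] by simp
  finally show ?case .
qed

theorem theorem1:
  fixes M :: "'a measure"
    and x :: "real ^ 'n"
    and \<epsilon> :: "'a \<Rightarrow> real ^ 'n"
  assumes "prob_space M"
    and "norm x = 1"
    and "prob_space.indep_vars M (\<lambda>_. borel) (\<lambda>i \<omega>. \<epsilon> \<omega> $ i) UNIV"
    and "\<And>i. measure M {\<omega> \<in> space M. \<epsilon> \<omega> $ i = 1} = 1 / 2"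
    and "\<And>i. measure M {\<omega> \<in> space M. \<epsilon> \<omega> $ i = - 1} = 1 / 2"
  shows "measure M {\<omega> \<in> space M. \<bar>\<epsilon> \<omega> \<bullet> x\<bar> \<le> 1} \<ge> 0.36"
proof -
  interpret prob_space M by fact
  obtain js :: "'n list" where js: "set js = UNIV" "distinct js"
    using finite_distinct_list[OF finite_class.finite_UNIV] by blast
  \<comment> \<open>Negated keys turn the ascending sort into one by decreasing absolute
    value.\<close>
  define ks where "ks = sort_key (\<lambda>i. - \<bar>x $ i\<bar>) js"
  have ks: "set ks = UNIV" "distinct ks"
    using js by (auto simp: ks_def)
  let ?zs = "map abs (map (($) x) ks)"
  have "sorted (map (\<lambda>i. - \<bar>x $ i\<bar>) ks)"
    by (simp add: ks_def)
  then have sorted: "sorted_wrt (\<ge>) ?zs"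
    by (simp add: sorted_wrt_map)
  have "(\<Sum>z\<leftarrow>?zs. z\<^sup>2) = (\<Sum>i\<in>UNIV. (x $ i)\<^sup>2)"
    using ks sum_list_distinct_conv_sum_set[of ks "\<lambda>i. (x $ i)\<^sup>2"] by (simp add: o_def)
  also have "\<dots> = 1"
    using assms(2) by (simp add: norm_eq_1 inner_vec_def power2_eq_square)
  finally have "0.36 \<le> sign_avg ?zs (\<lambda>r. of_bool (\<bar>r\<bar> \<le> 1))"
    using sorted by (intro sign_avg_sorted) auto
  \<comment> \<open>Random signs absorb the absolute values, so the original coordinates
    return.\<close>
  also have "\<dots> = sign_avg (map (($) x) ks) (indicator {-1..1})"
    unfolding sign_avg_map_abs by (rule arg_cong[of _ _ "sign_avg _"]) (auto simp: fun_eq_iff indicator_def abs_le_iff)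
  also have "\<dots> = prob {\<omega> \<in> space M. (\<Sum>i\<in>set ks. \<epsilon> \<omega> $ i * x $ i) \<in> {-1..1}}"
    using assms ks by (intro prob_sign_sum[symmetric]) auto
  also have "\<dots> = prob {\<omega> \<in> space M. \<bar>\<epsilon> \<omega> \<bullet> x\<bar> \<le> 1}"
    by (rule arg_cong[of _ _ prob]) (auto simp: ks inner_vec_def)
  finally show ?thesis .
qed

end
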